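(* Let $G=\{(z+w,zw):|z|<1,\ |w|<1\}\subset\mathbb{C}^2$. For any two points $x=(s_1,p_1)$, $y=(s_2,p_2)$ of $G$, $$C_G(x,y)=\sup_{\omega\in\mathbb{T}}\rho(\Phi_\omega(x),\Phi_\omega(y))=\sup_{\omega\in\mathbb{T}}\left|\frac{(s_2p_1-s_1p_2)\omega^2+2(p_2-p_1)\omega+s_1-s_2}{(s_1-\bar s_2p_1)\omega^2-2(1-p_1\bar p_2)\omega+\bar s_2-s_1\bar p_2}\right|,$$ where $\Phi_\omega(s,p)=\dfrac{2\omega p-s}{2-\omega s}$ for $(s,p)\in G$ and $\omega\in\mathbb{T}$.
   Context: $\mathbb{D}$ and $\mathbb{T}$ are the open unit disc and the unit circle in $\mathbb{C}$. It is known that $\Phi_\omega$ maps $G$ into $\mathbb{D}$ for $\omega\in\mathbb{T}$. $\rho$ is the pseudohyperbolic distance on $\mathbb{D}$, $\rho(z,w)=\left|\frac{z-w}{1-\bar w z}\right|$. The Carathéodory distance on $G$ is $C_G(x,y)=\sup_F\rho(F(x),F(y))$, the supremum being over all analytic functions $F:G\to\mathbb{D}$. *)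

theory Defs
  imports "HOL-Analysis.Analysis"
begin

definition sym_bidisc :: "(complex \<times> complex) set"
  where "sym_bidisc = {(z + w, z * w) | z w. cmod z < 1 \<and> cmod w < 1}"

text \<open>
  Analyticity of a function of two complex variables: on an open set, complex Frechet
  differentiability at every point, i.e. the real derivative exists and is complex linear.
  The notion is only meant for open sets, such as the symmetrized bidisc.
\<close>

definition analytic2_on :: "(complex \<times> complex \<Rightarrow> complex) \<Rightarrow> (complex \<times> complex) set \<Rightarrow> bool"
  where "analytic2_on F S \<longleftrightarrow>
    (\<forall>x\<in>S. \<exists>a b. (F has_derivative (\<lambda>(h, k). a * h + b * k)) (at x within S))"

definition pseudohyp_dist :: "complex \<Rightarrow> complex \<Rightarrow> real"
  where "pseudohyp_dist z w = cmod ((z - w) / (1 - cnj w * z))"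

text \<open>
  The real supremum is a genuine one: constant functions show that the index set is nonempty, and
  \<open>pseudohyp_dist\<close> is bounded by 1 on the unit disc.
\<close>

definition caratheodory_dist ::
    "(complex \<times> complex) set \<Rightarrow> complex \<times> complex \<Rightarrow> complex \<times> complex \<Rightarrow> real"
  where "caratheodory_dist S x y =
    (SUP F \<in> {F. analytic2_on F S \<and> F ` S \<subseteq> ball 0 1}. pseudohyp_dist (F x) (F y))"

definition Phi :: "complex \<Rightarrow> complex \<times> complex \<Rightarrow> complex"
  where "Phi \<omega> = (\<lambda>(s, p). (2 * \<omega> * p - s) / (2 - \<omega> * s))"

end

theory Submission
  imports Defs "HOL-Complex_Analysis.Conformal_Mappings"
begin

text \<open>
  Each \<open>\<Phi>\<^sub>\<omega>\<close> competes in the supremum that defines the Caratheodory distance, so the point is the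
  bound \<open>\<rho>(F x, F y) \<le> max\<^sub>\<omega> \<rho>(\<Phi>\<^sub>\<omega> x, \<Phi>\<^sub>\<omega> y)\<close> for an arbitrary analytic \<open>F\<close>. It is proved
  by producing, for \<open>x \<noteq> y\<close>, an explicit analytic disc through \<open>x\<close> and \<open>y\<close> on which the extremal
  \<open>\<Phi>\<^sub>\<omega>\<close> is an isomorphism onto the unit disc; the Schwarz-Pick lemma on that disc then bounds \<open>\<rho>(F x, F y)\<close>.

  By compactness of the circle the maximum is attained, and after a rotation it is attained at
  \<open>\<omega> = 1\<close>. Now move to the upper half-plane by the Cayley transform
  \<open>a = \<i> (1 + z) / (1 - z)\<close>, which sends 1 to infinity, and describe the unordered pair \<open>{a, b}\<close> by its
  midpoint \<open>m = (a + b)/2\<close> and its squared half-difference \<open>D = ((a - b)/2)\<^sup>2\<close>. In these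
  coordinates \<open>\<Phi>\<^sub>1\<close> is the midpoint \<open>m\<close>, up to an isomorphism of the half-plane with the disc, and
  the other \<open>\<Phi>\<^sub>\<omega>\<close> are, again up to such an isomorphism, the functions
  \<open>m - \<xi> - D / (m - \<xi>)\<close> for real \<open>\<xi>\<close>
  (\<open>pseudohyp_dist_Phi\<close>, \<open>midpoint_rotated\<close>).

  Suppose that \<open>(m\<^sub>1, D\<^sub>1)\<close> and \<open>(m\<^sub>2, D\<^sub>2)\<close> are points with \<open>m\<^sub>1 \<noteq> m\<^sub>2\<close> for which \<open>\<omega> = 1\<close> is extremal.
  For every real \<open>\<xi>\<close> the two-point Pick matrix of \<open>m\<^sub>i \<mapsto> m\<^sub>i - \<xi> - D\<^sub>i / (m\<^sub>i - \<xi>)\<close> is then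
  positive semidefinite. Letting \<open>\<xi>\<close> vary, its first-order part gives a real quadratic polynomial \<open>q\<close>
  with \<open>D\<^sub>i = q(m\<^sub>i)\<close> (\<open>pick_stationary\<close>, \<open>interpolate_real_quadratic\<close>), and its sign gives that
  \<open>q\<close> is nonnegative on the real line with leading coefficient at most 1
  (\<open>pick_quadratic_nonneg\<close>). For such a \<open>q\<close> that also passes through a point of the domain, the whole
  graph \<open>\<tau> \<mapsto> (\<tau>, q(\<tau>))\<close> over the half-plane stays in the domain
  (\<open>quadratic_disc_stays_inside\<close>). This graph is the required disc: the midpoint, that is
  \<open>\<Phi>\<^sub>1\<close>, is its coordinate.
\<close>

section \<open>The Cayley transform and the pseudohyperbolic distance\<close>

definition cayley :: "complex \<Rightarrow> complex"
  where "cayley z = \<i> * (1 + z) / (1 - z)"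

definition cayley_inv :: "complex \<Rightarrow> complex"
  where "cayley_inv a = (a - \<i>) / (a + \<i>)"

definition halfplane_dist :: "complex \<Rightarrow> complex \<Rightarrow> real"
  where "halfplane_dist a b = cmod ((a - b) / (a - cnj b))"

lemma Im_cayley_pos:
  assumes "cmod z < 1"
  shows "Im (cayley z) > 0"
proof -
  have "1 - z \<noteq> 0" using assms by auto
  moreover have "(Re z)\<^sup>2 + (Im z)\<^sup>2 < 1"
    using assms by (simp add: cmod_def)
  ultimately have "Im (cayley z) = (1 - (cmod z)\<^sup>2) / (cmod (1 - z))\<^sup>2"
    by (simp add: cayley_def Im_divide cmod_power2) (simp add: algebra_simps power2_eq_square)
  with assms \<open>1 - z \<noteq> 0\<close> show ?thesis
    by (simp add: power_less_one_iff abs_square_less_1)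
qed

lemma upper_halfplane_plus_i_nonzero: "Im a > 0 \<Longrightarrow> a + \<i> \<noteq> 0"
  by (auto simp: complex_eq_iff)

lemma upper_halfplane_minus_cnj_nonzero: "Im a > 0 \<Longrightarrow> Im b > 0 \<Longrightarrow> a - cnj b \<noteq> 0"
  by (auto simp: complex_eq_iff)

lemma upper_halfplane_minus_real_nonzero: "Im a > 0 \<Longrightarrow> a - complex_of_real \<xi> \<noteq> 0"
  by (auto simp: complex_eq_iff)

lemma norm_cayley_inv_less_1:
  assumes "Im a > 0"
  shows "cmod (cayley_inv a) < 1"
proof -
  have "(cmod (a - \<i>))\<^sup>2 < (cmod (a + \<i>))\<^sup>2"
    using assms unfolding cmod_power2 by (simp add: power2_eq_square algebra_simps)
  then have "cmod (a - \<i>) < cmod (a + \<i>)"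
    by (rule power_less_imp_less_base) simp
  then show ?thesis
    using upper_halfplane_plus_i_nonzero[OF assms] by (simp add: cayley_inv_def norm_divide)
qed

lemma cayley_inv_cayley: "z \<noteq> 1 \<Longrightarrow> cayley_inv (cayley z) = z"
proof -
  assume "z \<noteq> 1"
  then have n: "1 - z \<noteq> 0" by simp
  have "cayley z - \<i> = 2 * \<i> * z / (1 - z)" "cayley z + \<i> = 2 * \<i> / (1 - z)"
    using n by (simp_all add: cayley_def field_simps)
  then show ?thesis using n by (simp add: cayley_inv_def)
qed

lemma pseudohyp_denominator_nonzero:
  fixes z w :: complex
  assumes "cmod z < 1" "cmod w < 1"
  shows "1 - cnj w * z \<noteq> 0"
proof -
  have "cmod (cnj w * z) < 1 * 1"
    unfolding norm_mult using assms by (intro mult_strict_mono) auto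
  then show ?thesis by auto
qed

lemma pseudohyp_dist_unimodular_mult:
  assumes "cmod c = 1"
  shows "pseudohyp_dist (c * z) (c * w) = pseudohyp_dist z w"
proof -
  have "cnj c * c = 1"
    using assms by (metis complex_norm_square mult.commute of_real_1 one_power2)
  then have "cnj (c * w) * (c * z) = cnj w * z"
    by (simp add: mult.assoc)
  moreover have "c * z - c * w = c * (z - w)" by (simp add: algebra_simps)
  ultimately show ?thesis
    using assms unfolding pseudohyp_dist_def by (simp only: norm_divide norm_mult)
qed

lemma pseudohyp_dist_cayley_inv:
  assumes "Im a > 0" "Im b > 0"
  shows "pseudohyp_dist (cayley_inv a) (cayley_inv b) = halfplane_dist a b"
proof -
  have n: "a + \<i> \<noteq> 0" "b + \<i> \<noteq> 0"
    using assms upper_halfplane_plus_i_nonzero by auto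
  then have n': "cnj b - \<i> \<noteq> 0"
    by (metis complex_cnj_add complex_cnj_cnj complex_cnj_i complex_cnj_zero_iff diff_conv_add_uminus)
  have *: "cayley_inv a - cayley_inv b = 2 * \<i> * (a - b) / ((a + \<i>) * (b + \<i>))"
    using n by (simp add: cayley_inv_def field_simps)
  have **: "1 - cnj (cayley_inv b) * cayley_inv a = (-2 * \<i>) * (a - cnj b) / ((a + \<i>) * (cnj b - \<i>))"
    using n n' by (simp add: cayley_inv_def divide_simps) (simp add: algebra_simps)
  have "cmod (b + \<i>) = cmod (cnj b - \<i>)"
    by (metis complex_cnj_add complex_cnj_i complex_mod_cnj diff_conv_add_uminus)
  then show ?thesis
    using n n' unfolding pseudohyp_dist_def halfplane_dist_def * **
    by (simp add: norm_divide norm_mult)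
qed

text \<open>
  The Cayley transform turns the claim into \<open>\<bar>a - b\<bar> < \<bar>a - cnj b\<bar>\<close> for \<open>a, b\<close> in the upper
  half-plane.
\<close>
lemma pseudohyp_dist_less_1:
  assumes "cmod z < 1" "cmod w < 1"
  shows "pseudohyp_dist z w < 1"
proof -
  have "cayley_inv (cayley z) = z" "cayley_inv (cayley w) = w" 
    using assms by (auto intro!: cayley_inv_cayley)
  moreover define a b where "a = cayley z" "b = cayley w"
  moreover have ab: "Im a > 0" "Im b > 0" 
    using assms by (auto simp: a_b_def intro!: Im_cayley_pos)
  ultimately have "pseudohyp_dist z w = halfplane_dist a b"
    using pseudohyp_dist_cayley_inv[of a b] by simp
  moreover have "(cmod (a - b))\<^sup>2 < (cmod (a - cnj b))\<^sup>2"
    using ab unfolding cmod_power2 by (simp add: power2_eq_square algebra_simps)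
  then have "cmod (a - b) < cmod (a - cnj b)"
    by (rule power_less_imp_less_base) simp
  ultimately show ?thesis
    using upper_halfplane_minus_cnj_nonzero[OF ab] by (simp add: halfplane_dist_def norm_divide)
qed

lemma halfplane_dist_real_affine:
  fixes c r :: real and a b :: complex
  assumes "r > 0"
  shows "halfplane_dist (c + r * a) (c + r * b) = halfplane_dist a b"
proof -
  have "c + r * a - (c + r * b) = r * (a - b)" "c + r * a - cnj (c + r * b) = r * (a - cnj b)"
    by (simp_all add: algebra_simps)
  then show ?thesis using assms unfolding halfplane_dist_def by simp
qed

lemma halfplane_dist_inversion:
  assumes "a \<noteq> 0" "b \<noteq> 0"
  shows "halfplane_dist (- 1 / a) (- 1 / b) = halfplane_dist a b"
proof -
  have "- 1 / a - (- 1 / b) = (a - b) / (a * b)"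
       "- 1 / a - cnj (- 1 / b) = (a - cnj b) / (a * cnj b)"
    using assms by (simp_all add: field_simps)
  then show ?thesis using assms unfolding halfplane_dist_def
    by (simp add: norm_divide norm_mult)
qed

section \<open>The functions \<open>\<Phi>\<^sub>\<omega>\<close> in half-plane coordinates\<close>

text \<open>
  Writing \<open>u = \<omega> z\<close> and \<open>v = \<omega> w\<close>, both sides are a unimodular constant times
  \<open>(u + v - 2uv) / (2 - u - v)\<close>. So in half-plane coordinates \<open>\<Phi>\<^sub>\<omega>\<close> forgets everything about
  the rotated pair of points except its midpoint, which is what makes the half-plane the right model.
\<close>
lemma Phi_eq_cayley_inv_midpoint:
  assumes "cmod z < 1" "cmod w < 1" "cmod \<omega> = 1"
  shows "Phi \<omega> (z + w, z * w) =
           - cnj \<omega> * cayley_inv ((cayley (\<omega> * z) + cayley (\<omega> * w)) / 2)"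
proof -
  define u v where "u = \<omega> * z" and "v = \<omega> * w"
  have uv: "cmod u < 1" "cmod v < 1"
    using assms by (simp_all add: u_def v_def norm_mult)
  then have n: "1 - u \<noteq> 0" "1 - v \<noteq> 0" by auto
  define m where "m = (cayley u + cayley v) / 2"
  have 1: "m = \<i> * (1 - u * v) / ((1 - u) * (1 - v))"
    using n by (simp add: m_def cayley_def divide_simps) (simp add: algebra_simps)
  have 2: "m - \<i> = \<i> * (u + v - 2 * u * v) / ((1 - u) * (1 - v))"
    using n by (simp add: 1 divide_simps) (simp add: algebra_simps)
  have 3: "m + \<i> = \<i> * (2 - u - v) / ((1 - u) * (1 - v))"
    using n by (simp add: 1 divide_simps) (simp add: algebra_simps)
  have c: "cayley_inv m = (u + v - 2 * u * v) / (2 - u - v)"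
    using n unfolding cayley_inv_def 2 3 by simp
  have "cnj \<omega> * \<omega> = 1"
    using assms by (metis complex_norm_square mult.commute of_real_1 one_power2)
  then have "cnj \<omega> * (u + v - 2 * u * v) = z + w - 2 * \<omega> * (z * w)"
    unfolding u_def v_def by algebra
  then have "- cnj \<omega> * cayley_inv m = - (z + w - 2 * \<omega> * (z * w)) / (2 - u - v)"
    unfolding c by simp
  also have "\<dots> = Phi \<omega> (z + w, z * w)"
    by (simp add: Phi_def u_def v_def algebra_simps)
  finally show ?thesis by (simp add: m_def u_def v_def)
qed

lemma pseudohyp_dist_Phi:
  assumes "cmod z < 1" "cmod w < 1" "cmod z' < 1" "cmod w' < 1" "cmod \<omega> = 1"
  shows "pseudohyp_dist (Phi \<omega> (z + w, z * w)) (Phi \<omega> (z' + w', z' * w')) =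
    halfplane_dist ((cayley (\<omega> * z) + cayley (\<omega> * w)) / 2)
                   ((cayley (\<omega> * z') + cayley (\<omega> * w')) / 2)"
proof -
  have "Im (cayley (\<omega> * z)) > 0" "Im (cayley (\<omega> * w)) > 0"
       "Im (cayley (\<omega> * z')) > 0" "Im (cayley (\<omega> * w')) > 0"
    using assms by (auto intro!: Im_cayley_pos simp: norm_mult)
  moreover have "cmod (- cnj \<omega>) = 1" using assms by simp
  ultimately show ?thesis
    using assms
    by (simp only: Phi_eq_cayley_inv_midpoint pseudohyp_dist_unimodular_mult)
       (subst pseudohyp_dist_cayley_inv, auto)
qed

lemma norm_Phi_less_1:
  assumes "x \<in> sym_bidisc" "cmod \<omega> = 1"
  shows "cmod (Phi \<omega> x) < 1"
proof -
  obtain z w where x: "x = (z + w, z * w)" "cmod z < 1" "cmod w < 1"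
    using assms by (auto simp: sym_bidisc_def)
  then have "Im (cayley (\<omega> * z)) > 0" "Im (cayley (\<omega> * w)) > 0"
    using assms by (auto intro!: Im_cayley_pos simp: norm_mult)
  then have "cmod (cayley_inv ((cayley (\<omega> * z) + cayley (\<omega> * w)) / 2)) < 1"
    by (intro norm_cayley_inv_less_1) simp
  then show ?thesis
    using x assms by (simp add: Phi_eq_cayley_inv_midpoint norm_mult)
qed

text \<open>
  A rotation of the disc becomes a Moebius map of the half-plane with a real pole. Every real \<open>\<xi>\<close>
  is the pole for exactly one rotation, the one that takes the boundary point with Cayley image
  \<open>\<xi>\<close> to 1; only the identity, whose pole is infinity, is left out.
\<close>
lemma cayley_rotation:
  fixes \<xi> :: real
  assumes "cmod z < 1"
  shows "cayley ((\<xi> + \<i>) / (\<xi> - \<i>) * z) = - \<xi> - (1 + \<xi>\<^sup>2) / (cayley z - \<xi>)"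
proof -
  have n: "complex_of_real \<xi> - \<i> \<noteq> 0" by (auto simp: complex_eq_iff)
  have nz: "1 - z \<noteq> 0" using assms by auto
  have na: "cayley z - \<xi> \<noteq> 0"
    using Im_cayley_pos[OF assms] by (rule upper_halfplane_minus_real_nonzero)
  define d where "d = (\<xi> - \<i>) - (\<xi> + \<i>) * z"
  have cz: "cayley z - \<xi> = - d / (1 - z)"
    using nz by (simp add: cayley_def d_def field_simps)
  with na have nd: "d \<noteq> 0" by auto
  have l: "cayley ((\<xi> + \<i>) / (\<xi> - \<i>) * z) = \<i> * ((\<xi> - \<i>) + (\<xi> + \<i>) * z) / d"
  proof -
    have "1 + (\<xi> + \<i>) / (\<xi> - \<i>) * z = ((\<xi> - \<i>) + (\<xi> + \<i>) * z) / (\<xi> - \<i>)"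
         "1 - (\<xi> + \<i>) / (\<xi> - \<i>) * z = d / (\<xi> - \<i>)"
      using n by (simp_all add: d_def field_simps)
    then show ?thesis using n unfolding cayley_def by simp
  qed
  have r: "- \<xi> - (1 + \<xi>\<^sup>2) / (cayley z - \<xi>) = (- \<xi> * d + (1 + \<xi>\<^sup>2) * (1 - z)) / d"
    unfolding cz using nd nz by (simp add: field_simps)
  have "\<i> * ((\<xi> - \<i>) + (\<xi> + \<i>) * z) = - \<xi> * d + (1 + \<xi>\<^sup>2) * (1 - z)"
    unfolding d_def by (simp add: algebra_simps power2_eq_square)
  with l r show ?thesis by simp
qed

section \<open>Two-point Pick conditions force a quadratic relation\<close>

definition real_quadratic :: "real \<Rightarrow> real \<Rightarrow> real \<Rightarrow> complex \<Rightarrow> complex"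
  where "real_quadratic A B C m = of_real A * m\<^sup>2 + of_real B * m + of_real C"

text \<open>
  If \<open>m\<close> and \<open>D\<close> are the midpoint and the squared half-difference of \<open>a\<close> and \<open>b\<close>, this is the
  harmonic mean of \<open>a - \<xi>\<close> and \<open>b - \<xi>\<close>: the half-plane version of \<open>\<Phi>\<^sub>\<omega>\<close> for the rotation
  \<open>\<omega>\<close> with pole \<open>\<xi>\<close>, up to an automorphism of the half-plane.
\<close>
definition pole_coord :: "real \<Rightarrow> complex \<Rightarrow> complex \<Rightarrow> complex"
  where "pole_coord \<xi> m D = (m - of_real \<xi>) - D / (m - of_real \<xi>)"

text \<open>
  The determinant form of the two-point Pick condition. It is the inequality between the numbers
  \<open>1 - d\<^sup>2\<close> for the two distances \<open>d\<close>, since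
  \<open>1 - d(a, b)\<^sup>2 = 4 Im a Im b / \<bar>a - cnj b\<bar>\<^sup>2\<close>.
\<close>
lemma halfplane_dist_le_imp_pick:
  assumes "Im u > 0" "Im v > 0" "Im m > 0" "Im n > 0"
    and le: "halfplane_dist u v \<le> halfplane_dist m n"
  shows "(cmod ((u - cnj v) / (m - cnj n)))\<^sup>2 \<le> (Im u / Im m) * (Im v / Im n)"
proof -
  have sq: "(halfplane_dist a b)\<^sup>2 = 1 - 4 * Im a * Im b / (cmod (a - cnj b))\<^sup>2"
    if "Im a > 0" "Im b > 0" for a b
  proof -
    have "cmod (a - cnj b) \<noteq> 0"
      using upper_halfplane_minus_cnj_nonzero[OF that] by simp
    moreover have "(cmod (a - b))\<^sup>2 = (cmod (a - cnj b))\<^sup>2 - 4 * Im a * Im b"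
      unfolding cmod_power2 by (simp add: power2_eq_square algebra_simps)
    ultimately show ?thesis
      unfolding halfplane_dist_def norm_divide power_divide by (simp add: diff_divide_distrib)
  qed
  have "(halfplane_dist u v)\<^sup>2 \<le> (halfplane_dist m n)\<^sup>2"
    using le by (intro power_mono) (auto simp: halfplane_dist_def)
  then have le2: "Im m * Im n / (cmod (m - cnj n))\<^sup>2 \<le> Im u * Im v / (cmod (u - cnj v))\<^sup>2"
    using assms by (simp add: sq)
  have pos: "(cmod (u - cnj v))\<^sup>2 > 0" "(cmod (m - cnj n))\<^sup>2 > 0"
    using upper_halfplane_minus_cnj_nonzero[of u v] upper_halfplane_minus_cnj_nonzero[of m n] assms
    by auto
  have "Im m * Im n > 0" using assms by simp
  with le2 pos have "(cmod (u - cnj v))\<^sup>2 / (cmod (m - cnj n))\<^sup>2 \<le> (Im u * Im v) / (Im m * Im n)"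
    by (simp add: divide_simps mult_ac split: if_splits)
  then show ?thesis by (simp add: norm_divide power_divide)
qed

lemma affine_nonneg_imp_slope_zero:
  fixes K S :: real
  assumes "\<And>\<xi>. K + \<xi> * S \<ge> 0"
  shows "S = 0"
proof (rule ccontr)
  assume "S \<noteq> 0"
  then have "K + (- (K + 1) / S) * S < 0" by simp
  with assms[of "- (K + 1) / S"] show False by linarith
qed

text \<open>
  The condition that the pole at infinity is extremal, to first order. Put \<open>n\<^sub>i = m\<^sub>i - \<xi>\<close> and scale
  the Pick matrix of the data \<open>m\<^sub>i \<mapsto> pole_coord \<xi> m\<^sub>i D\<^sub>i\<close> by \<open>n\<^sub>i\<close> on both sides; its
  entries become quadratic polynomials in \<open>\<xi>\<close>, all with leading coefficient 1. Evaluated on the vector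
  \<open>(1, -1)\<close> the quadratic terms cancel, and a function of \<open>\<xi>\<close> remains that is affine and nonnegative
  on the whole real line. Its slope \<open>S\<close> therefore vanishes, which is the stated identity.
\<close>
lemma pick_stationary:
  assumes m: "Im m1 > 0" "Im m2 > 0"
    and pos: "\<And>\<xi>. Im (pole_coord \<xi> m1 D1) > 0" "\<And>\<xi>. Im (pole_coord \<xi> m2 D2) > 0"
    and le: "\<And>\<xi>. halfplane_dist (pole_coord \<xi> m1 D1) (pole_coord \<xi> m2 D2) \<le> halfplane_dist m1 m2"
  shows "Im D1 / Im m1 + Im D2 / Im m2 = 2 * Re ((D1 - cnj D2) / (m1 - cnj m2))"
proof -
  define d where "d = m1 - cnj m2"
  have d: "d \<noteq> 0" using upper_halfplane_minus_cnj_nonzero[OF m] by (simp add: d_def)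
  define S where "S = Im D1 / Im m1 + Im D2 / Im m2 - 2 * Re ((D1 - cnj D2) / d)"
  define K where "K = (cmod m1)\<^sup>2 - Im (D1 * cnj m1) / Im m1 + ((cmod m2)\<^sup>2 - Im (D2 * cnj m2) / Im m2)
        - 2 * Re (m1 * cnj m2 - (D1 * cnj m2 - cnj D2 * m1) / d)"
  have "K + \<xi> * S \<ge> 0" for \<xi> :: real
  proof -
    define n1 n2 u v where "n1 = m1 - of_real \<xi>" and "n2 = m2 - of_real \<xi>"
      and "u = pole_coord \<xi> m1 D1" and "v = pole_coord \<xi> m2 D2"
    note defs = n1_def n2_def u_def v_def
    have "n1 \<noteq> 0" "n2 \<noteq> 0"
      using m by (auto simp: n1_def n2_def dest: upper_halfplane_minus_real_nonzero)
    then have nz: "n1 \<noteq> 0" "n2 \<noteq> 0" "cnj n2 \<noteq> 0" by auto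
    have uv: "Im u > 0" "Im v > 0" using pos by (simp_all add: defs)
    define E where "E = (u - cnj v) / d"
    have pick: "(cmod E)\<^sup>2 \<le> (Im u / Im m1) * (Im v / Im m2)"
      unfolding E_def d_def using halfplane_dist_le_imp_pick[OF uv m] le by (simp add: defs)
    have diag: "(cmod (m - of_real \<xi>))\<^sup>2 * (Im (pole_coord \<xi> m D) / Im m) =
        (cmod m)\<^sup>2 - Im (D * cnj m) / Im m - 2 * \<xi> * Re m + \<xi>\<^sup>2 + \<xi> * (Im D / Im m)"
      if "Im m > 0" for m D
    proof -
      define n where "n = m - of_real \<xi>"
      have n: "n \<noteq> 0" using that unfolding n_def by (rule upper_halfplane_minus_real_nonzero)
      have "of_real ((cmod n)\<^sup>2) * (n - D / n) = of_real ((cmod n)\<^sup>2) * n - D * cnj n"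
        unfolding complex_norm_square using n by (simp add: field_simps)
      from arg_cong[OF this, of Im]
      have "(cmod n)\<^sup>2 * Im (n - D / n) = (cmod n)\<^sup>2 * Im n - Im (D * cnj n)"
        by (simp only: times_complex.sel minus_complex.sel Re_complex_of_real Im_complex_of_real)
      moreover have "Im n = Im m" by (simp add: n_def)
      moreover have "Im (D * cnj n) = Im (D * cnj m) - \<xi> * Im D"
        by (simp add: n_def algebra_simps)
      moreover have "(cmod n)\<^sup>2 = (cmod m)\<^sup>2 - 2 * \<xi> * Re m + \<xi>\<^sup>2"
        unfolding cmod_power2 n_def by (simp add: power2_eq_square algebra_simps)
      ultimately show ?thesis
        using that by (simp add: pole_coord_def flip: n_def) (simp add: field_simps)
    qed
    have off: "n1 * cnj n2 * E = (m1 * cnj m2 - (D1 * cnj m2 - cnj D2 * m1) / d)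
        - \<xi> * (m1 + cnj m2) + \<xi>\<^sup>2 + \<xi> * ((D1 - cnj D2) / d)"
    proof -
      have "n1 * cnj n2 * (u - cnj v) = n1 * cnj n2 * (n1 - cnj n2) - (D1 * cnj n2 - cnj D2 * n1)"
        using nz by (simp add: u_def v_def pole_coord_def flip: n1_def n2_def)
           (simp add: field_simps)
      also have "\<dots> = n1 * cnj n2 * d - ((D1 * cnj m2 - cnj D2 * m1) - \<xi> * (D1 - cnj D2))"
        by (simp add: n1_def n2_def d_def algebra_simps)
      finally have *: "n1 * cnj n2 * E = n1 * cnj n2 - ((D1 * cnj m2 - cnj D2 * m1) - \<xi> * (D1 - cnj D2)) / d"
        using d by (simp add: E_def field_simps)
      have **: "n1 * cnj n2 = m1 * cnj m2 - \<xi> * (m1 + cnj m2) + \<xi>\<^sup>2"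
        by (simp add: n1_def n2_def algebra_simps power2_eq_square)
      show ?thesis unfolding * unfolding ** by (simp add: diff_divide_distrib add_divide_distrib algebra_simps)
    qed
    (* The determinant condition bounds the off-diagonal entry by the geometric mean of the diagonal
       entries X and Y; the arithmetic mean then gives X + Y - 2 Re (entry) >= 0, the value of the
       scaled Pick matrix at (1, -1). *)
    define X Y where "X = (cmod n1)\<^sup>2 * (Im u / Im m1)" and "Y = (cmod n2)\<^sup>2 * (Im v / Im m2)"
    have XY: "X \<ge> 0" "Y \<ge> 0" using uv m by (simp_all add: X_def Y_def)
    have "(cmod (n1 * cnj n2 * E))\<^sup>2 \<le> X * Y"
    proof -
      have "(cmod (n1 * cnj n2 * E))\<^sup>2 = ((cmod n1)\<^sup>2 * (cmod n2)\<^sup>2) * (cmod E)\<^sup>2"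
        by (simp add: norm_mult power_mult_distrib)
      also have "\<dots> \<le> ((cmod n1)\<^sup>2 * (cmod n2)\<^sup>2) * ((Im u / Im m1) * (Im v / Im m2))"
        using pick by (intro mult_left_mono) auto
      finally show ?thesis by (simp add: X_def Y_def mult_ac)
    qed
    moreover have "4 * (X * Y) \<le> (X + Y)\<^sup>2"
      using zero_le_power2[of "X - Y"] by (simp add: power2_eq_square algebra_simps)
    ultimately have "(2 * cmod (n1 * cnj n2 * E))\<^sup>2 \<le> (X + Y)\<^sup>2"
      by (simp add: power_mult_distrib)
    then have "2 * cmod (n1 * cnj n2 * E) \<le> X + Y"
      by (rule power2_le_imp_le) (use XY in simp)
    then have "2 * Re (n1 * cnj n2 * E) \<le> X + Y"
      using complex_Re_le_cmod[of "n1 * cnj n2 * E"] by linarith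
    moreover have "Re (n1 * cnj n2 * E) = Re (m1 * cnj m2 - (D1 * cnj m2 - cnj D2 * m1) / d)
        - \<xi> * (Re m1 + Re m2) + \<xi>\<^sup>2 + \<xi> * Re ((D1 - cnj D2) / d)"
      unfolding off plus_complex.sel minus_complex.sel
      by (simp add: Re_power2 del: times_divide_eq_right)
    ultimately show ?thesis
      using diag[OF m(1), of D1] diag[OF m(2), of D2]
      unfolding K_def S_def X_def Y_def by (simp add: defs algebra_simps)
  qed
  then have "S = 0" by (rule affine_nonneg_imp_slope_zero)
  then show ?thesis by (simp add: S_def d_def)
qed

text \<open>
  Real affine functions can match \<open>D\<^sub>1\<close> at \<open>m\<^sub>1\<close>, and they satisfy the stationarity identity, so
  one may subtract one. What is left at \<open>m\<^sub>2\<close> is \<open>\<kappa> (m\<^sub>2 - m\<^sub>1) (m\<^sub>2 - cnj m\<^sub>1)\<close> for a complex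
  \<open>\<kappa>\<close>, and the identity then reads \<open>Im \<kappa> \<cdot> \<bar>m\<^sub>2 - m\<^sub>1\<bar>\<^sup>2 = 0\<close>. With \<open>\<kappa>\<close> real this is the value of a
  real quadratic with roots \<open>m\<^sub>1\<close> and \<open>cnj m\<^sub>1\<close>.
\<close>
lemma interpolate_real_quadratic:
  assumes m: "Im m1 > 0" "Im m2 > 0" "m1 \<noteq> m2"
    and stat: "Im D1 / Im m1 + Im D2 / Im m2 = 2 * Re ((D1 - cnj D2) / (m1 - cnj m2))"
  obtains A B C where "D1 = real_quadratic A B C m1" "D2 = real_quadratic A B C m2"
proof -
  (* The real affine function B0 * m + C0 takes the value D1 at m1. *)
  define B0 where "B0 = Im D1 / Im m1"
  define C0 where "C0 = Re D1 - B0 * Re m1"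
  have D1: "D1 = B0 * m1 + C0"
    using m by (simp add: complex_eq_iff B0_def C0_def)
  have d: "m1 - cnj m2 \<noteq> 0" "m2 - cnj m1 \<noteq> 0" "m2 - m1 \<noteq> 0"
    using m upper_halfplane_minus_cnj_nonzero by auto
  define \<kappa> where "\<kappa> = (D2 - B0 * m2 - C0) / ((m2 - m1) * (m2 - cnj m1))"
  have D2: "D2 = B0 * m2 + C0 + \<kappa> * (m2 - m1) * (m2 - cnj m1)"
    using d by (simp add: \<kappa>_def)
  have "D1 - cnj D2 = (B0 + cnj (\<kappa> * (m2 - m1))) * (m1 - cnj m2)"
    unfolding D2 by (simp add: D1 algebra_simps)
  then have "(D1 - cnj D2) / (m1 - cnj m2) = B0 + cnj (\<kappa> * (m2 - m1))"
    using d by simp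
  then have "Re ((D1 - cnj D2) / (m1 - cnj m2)) = B0 + Re (\<kappa> * (m2 - m1))"
    by (simp only:) (simp add: algebra_simps)
  with stat have "Im D2 / Im m2 = B0 + 2 * Re (\<kappa> * (m2 - m1))"
    using m by (simp add: D1)
  then have "Im D2 = B0 * Im m2 + 2 * Im m2 * Re (\<kappa> * (m2 - m1))"
    using m by (simp add: field_simps)
  then have "Im (\<kappa> * (m2 - m1) * (m2 - cnj m1)) = 2 * Im m2 * Re (\<kappa> * (m2 - m1))"
    unfolding D2 by simp
  then have "Im \<kappa> * ((Re m2 - Re m1)\<^sup>2 + (Im m2 - Im m1)\<^sup>2) = 0"
    by (simp add: power2_eq_square algebra_simps)
  moreover have "(Re m2 - Re m1)\<^sup>2 + (Im m2 - Im m1)\<^sup>2 \<noteq> 0"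
    using m by (auto simp: sum_power2_eq_zero_iff complex_eq_iff)
  ultimately have "Im \<kappa> = 0" by auto
  then have \<kappa>: "\<kappa> = of_real (Re \<kappa>)" by (simp add: complex_eq_iff)
  define A where "A = Re \<kappa>"
  have split: "(m - m1) * (m - cnj m1) = m\<^sup>2 - of_real (2 * Re m1) * m + of_real ((cmod m1)\<^sup>2)" for m
    unfolding complex_norm_square complex_add_cnj[symmetric]
    by (simp add: power2_eq_square algebra_simps)
  have gen: "real_quadratic A (B0 - 2 * A * Re m1) (C0 + A * (cmod m1)\<^sup>2) m =
     B0 * m + C0 + of_real A * ((m - m1) * (m - cnj m1))" for m :: complex
    unfolding split real_quadratic_def by (simp add: algebra_simps)
  show thesis
  proof
    show "D1 = real_quadratic A (B0 - 2 * A * Re m1) (C0 + A * (cmod m1)\<^sup>2) m1"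
      unfolding gen by (simp add: D1)
    show "D2 = real_quadratic A (B0 - 2 * A * Re m1) (C0 + A * (cmod m1)\<^sup>2) m2"
      unfolding gen using D2 \<kappa> by (simp add: A_def mult.assoc)
  qed
qed

text \<open>
  When \<open>D\<^sub>i = q(m\<^sub>i)\<close> for a real quadratic \<open>q\<close> with leading coefficient \<open>A\<close>, the Pick matrix has the
  entries \<open>(1 - A) + q(\<xi>) / (n\<^sub>i cnj n\<^sub>j)\<close>, a combination of two independent rank one Gram matrices.
  It is positive semidefinite only if both coefficients are nonnegative: its determinant is
  \<open>(1 - A) q(\<xi>) \<bar>1/n\<^sub>1 - 1/n\<^sub>2\<bar>\<^sup>2\<close>, so the coefficients do not have opposite signs, and its
  positive diagonal excludes that both are negative.
\<close>
lemma pick_quadratic_nonneg: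
  assumes m: "Im m1 > 0" "Im m2 > 0" "m1 \<noteq> m2"
    and D: "D1 = real_quadratic A B C m1" "D2 = real_quadratic A B C m2"
    and pos: "Im (pole_coord \<xi> m1 D1) > 0" "Im (pole_coord \<xi> m2 D2) > 0"
    and le: "halfplane_dist (pole_coord \<xi> m1 D1) (pole_coord \<xi> m2 D2) \<le> halfplane_dist m1 m2"
  shows "A \<le> 1" "A * \<xi>\<^sup>2 + B * \<xi> + C \<ge> 0"
proof -
  define Q where "Q = A * \<xi>\<^sup>2 + B * \<xi> + C"
  define R where "R = 2 * A * \<xi> + B"
  define n1 n2 where "n1 = m1 - of_real \<xi>" and "n2 = m2 - of_real \<xi>"
  have "n1 \<noteq> 0" "n2 \<noteq> 0"
    using m by (auto simp: n1_def n2_def dest: upper_halfplane_minus_real_nonzero)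
  then have nz: "n1 \<noteq> 0" "n2 \<noteq> 0" "cnj n2 \<noteq> 0" by auto
  have n: "Im n1 = Im m1" "Im n2 = Im m2" by (simp_all add: n1_def n2_def)
  have taylor: "real_quadratic A B C m = Q + R * (m - \<xi>) + A * (m - \<xi>)\<^sup>2" for m :: complex
    by (simp add: real_quadratic_def Q_def R_def power2_eq_square algebra_simps)
  have D': "D1 = Q + R * n1 + A * n1\<^sup>2" "D2 = Q + R * n2 + A * n2\<^sup>2"
    by (simp_all only: n1_def n2_def D taylor)
  have coord: "pole_coord \<xi> m1 D1 = of_real (1 - A) * n1 - Q / n1 - R"
              "pole_coord \<xi> m2 D2 = of_real (1 - A) * n2 - Q / n2 - R"
    using nz unfolding pole_coord_def D'
    by (simp_all flip: n1_def n2_def) (simp_all add: field_simps power2_eq_square)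
  have Imq: "Im (complex_of_real Q / z) = - Q * Im z / (cmod z)\<^sup>2" for z
    by (simp add: Im_divide cmod_power2)
  have diag: "Im (pole_coord \<xi> m1 D1) / Im m1 = (1 - A) + Q / (cmod n1)\<^sup>2"
             "Im (pole_coord \<xi> m2 D2) / Im m2 = (1 - A) + Q / (cmod n2)\<^sup>2"
    unfolding coord using m by (simp_all add: Imq n add_divide_distrib)
  have d: "n1 - cnj n2 \<noteq> 0" "m1 - cnj m2 = n1 - cnj n2"
    using upper_halfplane_minus_cnj_nonzero[of n1 n2] m n by (simp_all add: n1_def n2_def)
  have "pole_coord \<xi> m1 D1 - cnj (pole_coord \<xi> m2 D2) =
     (of_real (1 - A) + Q / (n1 * cnj n2)) * (n1 - cnj n2)"
    unfolding coord using nz by (simp add: field_simps)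
  then have off: "(pole_coord \<xi> m1 D1 - cnj (pole_coord \<xi> m2 D2)) / (m1 - cnj m2) =
     of_real (1 - A) + Q / (n1 * cnj n2)"
    using d by simp
  have pick: "(cmod (of_real (1 - A) + Q / (n1 * cnj n2)))\<^sup>2 \<le>
      ((1 - A) + Q / (cmod n1)\<^sup>2) * ((1 - A) + Q / (cmod n2)\<^sup>2)"
    using halfplane_dist_le_imp_pick[OF pos m(1,2) le] unfolding off diag .
  (* The Gram determinant identity is polynomial in the inverses of n1 and n2. *)
  define i1 i2 where "i1 = 1 / n1" and "i2 = 1 / n2"
  have "i1 \<noteq> i2" using nz m by (auto simp: i1_def i2_def n1_def n2_def)
  have "Q / (n1 * cnj n2) = Q * i1 * cnj i2" "Q / (cmod n1)\<^sup>2 = Q * (cmod i1)\<^sup>2"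
       "Q / (cmod n2)\<^sup>2 = Q * (cmod i2)\<^sup>2"
    by (simp_all add: i1_def i2_def norm_divide power_divide)
  note ii = this
  have gram: "(\<alpha> + Q * (cmod i1)\<^sup>2) * (\<alpha> + Q * (cmod i2)\<^sup>2)
      - (cmod (of_real \<alpha> + Q * i1 * cnj i2))\<^sup>2 = \<alpha> * Q * (cmod (i1 - i2))\<^sup>2" for \<alpha> :: real
    unfolding cmod_power2 by (simp add: power2_eq_square algebra_simps)
  have "(1 - A) * Q * (cmod (i1 - i2))\<^sup>2 \<ge> 0"
    using pick unfolding ii using gram[of "1 - A"] by simp
  then have prod: "(1 - A) * Q \<ge> 0"
    using \<open>i1 \<noteq> i2\<close> by (simp add: zero_le_mult_iff)
  have "Im (pole_coord \<xi> m1 D1) / Im m1 > 0" using pos m by simp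
  then have sum: "(1 - A) + Q * (cmod i1)\<^sup>2 > 0"
    unfolding diag ii .
  have *: "\<alpha> \<ge> 0 \<and> Q \<ge> 0" if "\<alpha> * Q \<ge> 0" "\<alpha> + Q * t > 0" "t > 0" for \<alpha> t :: real
    using that by (smt (verit) mult_nonneg_nonneg mult_nonpos_nonneg mult_pos_neg mult_neg_pos)
  have "(cmod i1)\<^sup>2 > 0" using nz by (simp add: i1_def)
  from *[OF prod sum this] show "A \<le> 1" "A * \<xi>\<^sup>2 + B * \<xi> + C \<ge> 0"
    by (simp_all add: Q_def)
qed

section \<open>The analytic disc given by a nonnegative quadratic\<close>

lemma Re_sqrt_quadratic: "2 * (Im w)\<^sup>2 = cmod (w\<^sup>2) - Re (w\<^sup>2)"
  unfolding norm_power cmod_power2 Re_power2 by simp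

lemma nonneg_quadratic_complete_square:
  fixes A B C :: real
  assumes nonneg: "\<And>\<xi>. A * \<xi>\<^sup>2 + B * \<xi> + C \<ge> 0"
  obtains c K :: real where "A \<ge> 0" "K \<ge> 0" "\<And>m::complex. real_quadratic A B C m = A * (m - of_real c)\<^sup>2 + K"
proof (cases "A = 0")
  case True
  then have "C + \<xi> * B \<ge> 0" for \<xi> using nonneg[of \<xi>] by (simp add: algebra_simps)
  then have "B = 0" by (rule affine_nonneg_imp_slope_zero)
  with True nonneg[of 0] show thesis
    by (intro that[of C 0]) (auto simp: real_quadratic_def)
next
  case False
  define c where "c = - B / (2 * A)"
  define K where "K = C - A * c\<^sup>2"
  have B: "B = - 2 * A * c" using False by (simp add: c_def)
  have "K \<ge> 0" using nonneg[of c] by (simp add: K_def B power2_eq_square)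
  moreover have "A \<ge> 0"
  proof (rule ccontr)
    assume "\<not> A \<ge> 0"
    then have "A < 0" by simp
    (* At the distance t from the vertex c the quadratic is at most A < 0. *)
    define t where "t = 1 + K / \<bar>A\<bar>"
    have "t \<ge> 1" using \<open>K \<ge> 0\<close> by (simp add: t_def)
    then have "t \<le> t\<^sup>2" by (simp add: power2_eq_square)
    have "A * (t + c)\<^sup>2 + B * (t + c) + C = A * t\<^sup>2 + K"
      by (simp add: K_def B power2_eq_square algebra_simps)
    also have "\<dots> \<le> A * t + K" using \<open>t \<le> t\<^sup>2\<close> \<open>A < 0\<close> by simp
    also have "\<dots> = A" using \<open>A < 0\<close> by (simp add: t_def field_simps)
    finally show False using nonneg[of "t + c"] \<open>A < 0\<close> by linarith
  qed
  ultimately show thesis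
    by (intro that[of K c]) (auto simp: real_quadratic_def B K_def power2_eq_square algebra_simps)
qed

text \<open>
  For \<open>w\<^sup>2 = D\<close> one has \<open>2 (Im w)\<^sup>2 = \<bar>D\<bar> - Re D\<close>. The right-hand side is a subadditive function of
  \<open>D\<close> that vanishes on the nonnegative reals, so on \<open>A (\<tau> - c)\<^sup>2 + K\<close> it is at most
  \<open>2 A (Im \<tau>)\<^sup>2\<close>. This gives the weak inequality; the strict one can only fail when \<open>A = 1\<close> and
  \<open>K = 0\<close>, and then it would fail at every point, in particular at \<open>m\<close>.
\<close>
lemma quadratic_disc_stays_inside:
  assumes A: "A \<le> 1" and nonneg: "\<And>\<xi>. A * \<xi>\<^sup>2 + B * \<xi> + C \<ge> 0"
    and wit: "Im m > 0" "v\<^sup>2 = real_quadratic A B C m" "\<bar>Im v\<bar> < Im m"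
    and \<tau>: "Im \<tau> > 0" "w\<^sup>2 = real_quadratic A B C \<tau>"
  shows "\<bar>Im w\<bar> < Im \<tau>"
proof -
  obtain c K :: real where A0: "A \<ge> 0" and K: "K \<ge> 0"
    and q: "\<And>m::complex. real_quadratic A B C m = A * (m - of_real c)\<^sup>2 + K"
    by (rule nonneg_quadratic_complete_square[OF nonneg], rule that)
  define u where "u = \<tau> - of_real c"
  have u: "Im u = Im \<tau>" by (simp add: u_def)
  have w: "w\<^sup>2 = A * u\<^sup>2 + K" using \<tau> q by (simp add: u_def)
  have Re: "Re (w\<^sup>2) = A * (cmod u)\<^sup>2 + K - 2 * A * (Im u)\<^sup>2"
    unfolding w cmod_power2 by (simp add: Re_power2 algebra_simps)
  have le: "cmod (w\<^sup>2) \<le> A * (cmod u)\<^sup>2 + K"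
    unfolding w by (rule norm_triangle_le) (use A0 K in \<open>simp add: norm_mult norm_power\<close>)
  have "(Im w)\<^sup>2 < (Im u)\<^sup>2"
  proof (cases "A < 1")
    case True
    have "2 * (Im w)\<^sup>2 \<le> 2 * (A * (Im u)\<^sup>2)"
      unfolding Re_sqrt_quadratic[of w] Re using le by simp
    moreover have "A * (Im u)\<^sup>2 < 1 * (Im u)\<^sup>2"
      using True \<tau> by (intro mult_strict_right_mono) (auto simp: u)
    ultimately show ?thesis by simp
  next
    case False
    with A have A1: "A = 1" by simp
    (* If K = 0 then v = m - c up to sign, so that |Im v| = Im m. *)
    have "K > 0"
    proof (rule ccontr)
      assume "\<not> K > 0"
      with K have "v\<^sup>2 = (m - of_real c)\<^sup>2" using wit(2) q A1 by simp
      then have "v = m - of_real c \<or> v = - (m - of_real c)" by (simp add: power2_eq_iff)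
      with wit show False by auto
    qed
    have "(cmod (w\<^sup>2))\<^sup>2 = ((cmod u)\<^sup>2 + K)\<^sup>2 - 4 * K * (Im u)\<^sup>2"
      unfolding w A1 cmod_power2 by (simp add: Re_power2 Im_power2) (simp add: power2_eq_square algebra_simps)
    then have "(cmod (w\<^sup>2))\<^sup>2 < ((cmod u)\<^sup>2 + K)\<^sup>2"
      using \<open>K > 0\<close> \<tau> by (simp add: u)
    then have "cmod (w\<^sup>2) < (cmod u)\<^sup>2 + K"
      by (rule power_less_imp_less_base) (use K in simp)
    then have "2 * (Im w)\<^sup>2 < 2 * (Im u)\<^sup>2"
      unfolding Re_sqrt_quadratic[of w] Re A1 by simp
    then show ?thesis by simp
  qed
  then have "\<bar>Im w\<bar> < \<bar>Im u\<bar>" by (metis abs_le_square_iff linorder_not_le)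
  then show ?thesis using \<tau> by (simp add: u)
qed

text \<open>
  The Schwarz lemma, after moving \<open>n\<close> to 0 in the domain by a Cayley transform and \<open>h n\<close> to 0 in
  the target by a disc automorphism.
\<close>
lemma schwarz_pick_halfplane:
  assumes hol: "h holomorphic_on {\<tau>. Im \<tau> > 0}"
    and bound: "\<And>\<tau>. Im \<tau> > 0 \<Longrightarrow> cmod (h \<tau>) < 1"
    and m: "Im m > 0" "Im n > 0"
  shows "pseudohyp_dist (h m) (h n) \<le> halfplane_dist m n"
proof -
  define T where "T = (\<lambda>\<mu>. of_real (Re n) + of_real (Im n) * cayley \<mu>)"
  define b where "b = h n"
  define g where "g = (\<lambda>\<mu>. (h (T \<mu>) - b) / (1 - cnj b * h (T \<mu>)))"
  define l where "l = (m - n) / (m - cnj n)"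
  have d: "m - cnj n \<noteq> 0" using m by (intro upper_halfplane_minus_cnj_nonzero)
  have b: "cmod b < 1" using bound m by (simp add: b_def)
  have T0: "T 0 = n" by (simp add: T_def cayley_def complex_eq_iff)
  have nn: "n - cnj n = 2 * of_real (Im n) * \<i>" by (simp add: complex_eq_iff)
  have Tl: "T l = m"
  proof -
    have "1 - l = (n - cnj n) / (m - cnj n)" "1 + l = (2 * m - (n + cnj n)) / (m - cnj n)"
      using d by (simp_all add: l_def field_simps)
    moreover have "n + cnj n = 2 * of_real (Re n)" by (simp add: complex_eq_iff)
    ultimately have "cayley l = \<i> * (2 * m - 2 * of_real (Re n)) / (2 * of_real (Im n) * \<i>)"
      using d m by (simp add: cayley_def nn)
    also have "\<dots> = (m - of_real (Re n)) / of_real (Im n)"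
      using m by (simp add: field_simps)
    finally show ?thesis using m by (simp add: T_def)
  qed
  have dist: "cmod l = halfplane_dist m n" by (simp add: l_def halfplane_dist_def)
  have "halfplane_dist m n < 1"
    using pseudohyp_dist_less_1[OF norm_cayley_inv_less_1 norm_cayley_inv_less_1, OF m]
    by (simp add: pseudohyp_dist_cayley_inv m)
  then have l1: "cmod l < 1" by (simp add: dist)
  have ImT: "Im (T z) > 0" if "cmod z < 1" for z
    using Im_cayley_pos[OF that] m by (simp add: T_def)
  have holT: "T holomorphic_on ball 0 1"
    unfolding T_def cayley_def by (intro holomorphic_intros) auto
  have hT: "(\<lambda>z. h (T z)) holomorphic_on ball 0 1"
    using holomorphic_on_compose_gen[OF holT hol] ImT by (simp add: o_def image_subset_iff)
  have nz: "1 - cnj b * h (T z) \<noteq> 0" if "cmod z < 1" for z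
    using bound[OF ImT[OF that]] b by (rule pseudohyp_denominator_nonzero)
  have "g holomorphic_on ball 0 1"
    unfolding g_def using nz
    by (intro holomorphic_on_divide holomorphic_on_diff holomorphic_on_mult holomorphic_on_const hT) auto
  moreover have "g 0 = 0" by (simp add: g_def T0 b_def)
  moreover have "cmod (g z) < 1" if "cmod z < 1" for z
    using pseudohyp_dist_less_1[OF bound[OF ImT[OF that]] b] by (simp add: g_def pseudohyp_dist_def)
  ultimately have "cmod (g l) \<le> cmod l"
    using l1 by (rule Schwarz_Lemma(1))
  then show ?thesis
    by (simp add: dist g_def Tl b_def pseudohyp_dist_def)
qed

lemma holomorphic_on_compose_analytic2:
  assumes F: "analytic2_on F U" and f: "f holomorphic_on S" and g: "g holomorphic_on S"
    and sub: "\<And>\<tau>. \<tau> \<in> S \<Longrightarrow> (f \<tau>, g \<tau>) \<in> U"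
  shows "(\<lambda>\<tau>. F (f \<tau>, g \<tau>)) holomorphic_on S"
proof (rule holomorphic_onI)
  fix \<tau> assume \<tau>: "\<tau> \<in> S"
  obtain f' g' where "(f has_field_derivative f') (at \<tau> within S)"
      "(g has_field_derivative g') (at \<tau> within S)"
    using f g \<tau> unfolding holomorphic_on_def field_differentiable_def by blast
  then have fg: "((\<lambda>\<tau>. (f \<tau>, g \<tau>)) has_derivative (\<lambda>h. (f' * h, g' * h))) (at \<tau> within S)"
    by (intro has_derivative_Pair) (simp_all add: has_field_derivative_def)
  obtain a b where "(F has_derivative (\<lambda>(h, k). a * h + b * k)) (at (f \<tau>, g \<tau>) within U)"
    using F sub[OF \<tau>] unfolding analytic2_on_def by blast
  then have "(F has_derivative (\<lambda>(h, k). a * h + b * k))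
      (at (f \<tau>, g \<tau>) within (\<lambda>\<tau>. (f \<tau>, g \<tau>)) ` S)"
    by (rule has_derivative_subset) (use sub in auto)
  from has_derivative_in_compose[OF fg this]
  have "((\<lambda>\<tau>. F (f \<tau>, g \<tau>)) has_derivative (\<lambda>h. (a * f' + b * g') * h)) (at \<tau> within S)"
    by (simp add: algebra_simps)
  then show "(\<lambda>\<tau>. F (f \<tau>, g \<tau>)) field_differentiable at \<tau> within S"
    unfolding field_differentiable_def has_field_derivative_def by blast
qed

text \<open>
  The pair \<open>(z + w, z w)\<close> for \<open>z = cayley_inv (m + \<surd>D)\<close> and \<open>w = cayley_inv (m - \<surd>D)\<close>, written
  without the square root. It is rational in \<open>m\<close> and \<open>D\<close>, hence holomorphic along a disc also where
  the two points \<open>z\<close> and \<open>w\<close> collide.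
\<close>
definition sym_cayley_inv :: "complex \<Rightarrow> complex \<Rightarrow> complex \<times> complex"
  where "sym_cayley_inv m D =
    (2 * (m\<^sup>2 - D + 1) / (m\<^sup>2 - D + 2 * \<i> * m - 1),
     (m\<^sup>2 - D - 2 * \<i> * m - 1) / (m\<^sup>2 - D + 2 * \<i> * m - 1))"

lemma sym_cayley_inv_denominator:
  "m\<^sup>2 - w\<^sup>2 + 2 * \<i> * m - 1 = (m + w + \<i>) * (m - w + \<i>)"
  by (simp add: power2_eq_square algebra_simps)

lemma sym_cayley_inv_square:
  assumes "Im (m + w) > 0" "Im (m - w) > 0"
  shows "sym_cayley_inv m (w\<^sup>2) =
     (cayley_inv (m + w) + cayley_inv (m - w), cayley_inv (m + w) * cayley_inv (m - w))"
proof -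
  have n: "m + w + \<i> \<noteq> 0" "m - w + \<i> \<noteq> 0"
    using assms upper_halfplane_plus_i_nonzero by blast+
  have "2 * (m\<^sup>2 - w\<^sup>2 + 1) = (m + w - \<i>) * (m - w + \<i>) + (m - w - \<i>) * (m + w + \<i>)"
       "m\<^sup>2 - w\<^sup>2 - 2 * \<i> * m - 1 = (m + w - \<i>) * (m - w - \<i>)"
    by (simp_all add: power2_eq_square algebra_simps)
  with n show ?thesis
    unfolding sym_cayley_inv_def sym_cayley_inv_denominator cayley_inv_def
    by (simp add: add_frac_eq)
qed

text \<open>
  The map \<open>\<tau> \<mapsto> sym_cayley_inv \<tau> (q \<tau>)\<close> is an analytic disc in the symmetrized bidisc,
  parametrized by the half-plane, and so is its image under the rotation
  \<open>(s, p) \<mapsto> (\<eta> s, \<eta>\<^sup>2 p)\<close>. Restricting \<open>F\<close> to it leaves a function of one variable, to which the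
  Schwarz-Pick lemma applies.
\<close>
lemma pseudohyp_dist_le_on_quadratic_disc:
  assumes F: "analytic2_on F sym_bidisc" "F ` sym_bidisc \<subseteq> ball 0 1"
    and \<eta>: "cmod \<eta> = 1"
    and A: "A \<le> 1" and nonneg: "\<And>\<xi>. A * \<xi>\<^sup>2 + B * \<xi> + C \<ge> 0"
    and m: "\<bar>Im v1\<bar> < Im m1" "\<bar>Im v2\<bar> < Im m2"
    and v: "v1\<^sup>2 = real_quadratic A B C m1" "v2\<^sup>2 = real_quadratic A B C m2"
  shows "pseudohyp_dist (F (\<eta> * fst (sym_cayley_inv m1 (v1\<^sup>2)), \<eta>\<^sup>2 * snd (sym_cayley_inv m1 (v1\<^sup>2))))
                        (F (\<eta> * fst (sym_cayley_inv m2 (v2\<^sup>2)), \<eta>\<^sup>2 * snd (sym_cayley_inv m2 (v2\<^sup>2))))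
         \<le> halfplane_dist m1 m2"
proof -
  let ?H = "{\<tau>. Im \<tau> > 0}"
  define q where "q = real_quadratic A B C"
  have m0: "Im m1 > 0" "Im m2 > 0" using m by auto
  define f where "f = (\<lambda>\<tau>. \<eta> * fst (sym_cayley_inv \<tau> (q \<tau>)))"
  define g where "g = (\<lambda>\<tau>. \<eta>\<^sup>2 * snd (sym_cayley_inv \<tau> (q \<tau>)))"
  have inside: "(f \<tau>, g \<tau>) \<in> sym_bidisc \<and> \<tau>\<^sup>2 - q \<tau> + 2 * \<i> * \<tau> - 1 \<noteq> 0" if "Im \<tau> > 0" for \<tau>
  proof -
    define w where "w = csqrt (q \<tau>)"
    have w: "q \<tau> = w\<^sup>2" by (simp add: w_def)
    have "\<bar>Im w\<bar> < Im \<tau>"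
      by (rule quadratic_disc_stays_inside[OF A nonneg m0(1) v(1) m(1) that]) (simp add: q_def flip: w)
    then have pos: "Im (\<tau> + w) > 0" "Im (\<tau> - w) > 0" by auto
    have "(f \<tau>, g \<tau>) = (\<eta> * cayley_inv (\<tau> + w) + \<eta> * cayley_inv (\<tau> - w),
        (\<eta> * cayley_inv (\<tau> + w)) * (\<eta> * cayley_inv (\<tau> - w)))"
      unfolding f_def g_def w sym_cayley_inv_square[OF pos] by (simp add: power2_eq_square algebra_simps)
    moreover have "cmod (\<eta> * cayley_inv (\<tau> + w)) < 1" "cmod (\<eta> * cayley_inv (\<tau> - w)) < 1"
      using norm_cayley_inv_less_1[OF pos(1)] norm_cayley_inv_less_1[OF pos(2)] \<eta>
      by (simp_all add: norm_mult)
    ultimately have "(f \<tau>, g \<tau>) \<in> sym_bidisc"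
      unfolding sym_bidisc_def by blast
    moreover have "\<tau>\<^sup>2 - q \<tau> + 2 * \<i> * \<tau> - 1 \<noteq> 0"
      unfolding w sym_cayley_inv_denominator using pos upper_halfplane_plus_i_nonzero by simp
    ultimately show ?thesis ..
  qed
  have "f holomorphic_on ?H" "g holomorphic_on ?H"
    using inside unfolding f_def g_def q_def sym_cayley_inv_def real_quadratic_def fst_conv snd_conv
    by (auto intro!: holomorphic_intros)
  then have "(\<lambda>\<tau>. F (f \<tau>, g \<tau>)) holomorphic_on ?H"
    using inside by (intro holomorphic_on_compose_analytic2[OF F(1)]) auto
  moreover have "cmod (F (f \<tau>, g \<tau>)) < 1" if "Im \<tau> > 0" for \<tau>
    using inside[OF that] F(2) by force
  ultimately have "pseudohyp_dist (F (f m1, g m1)) (F (f m2, g m2)) \<le> halfplane_dist m1 m2"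
    using schwarz_pick_halfplane[of "\<lambda>\<tau>. F (f \<tau>, g \<tau>)", OF _ _ m0] by blast
  then show ?thesis by (simp add: f_def g_def q_def v)
qed

section \<open>Extremal pairs lie on a quadratic disc\<close>

text \<open>
  Up to a real affine map, the rotation with pole \<open>\<xi>\<close> sends \<open>\<alpha> = cayley z - \<xi>\<close> and
  \<open>\<beta> = cayley w - \<xi>\<close> to \<open>-1/\<alpha>\<close> and \<open>-1/\<beta>\<close>. Their average is \<open>-1/u\<close>, as \<open>u\<close> is the harmonic mean
  of \<open>\<alpha>\<close> and \<open>\<beta>\<close>.
\<close>
lemma midpoint_rotated:
  fixes \<xi> :: real
  assumes "cmod z < 1" "cmod w < 1"
  defines "\<omega> \<equiv> (of_real \<xi> + \<i>) / (of_real \<xi> - \<i>)"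
  defines "u \<equiv> pole_coord \<xi> ((cayley z + cayley w) / 2) (((cayley z - cayley w) / 2)\<^sup>2)"
  shows "(cayley (\<omega> * z) + cayley (\<omega> * w)) / 2 = of_real (- \<xi>) + of_real (1 + \<xi>\<^sup>2) * (- 1 / u)"
    and "Im u > 0"
proof -
  define \<alpha> \<beta> where "\<alpha> = cayley z - \<xi>" and "\<beta> = cayley w - \<xi>"
  have pos: "Im \<alpha> > 0" "Im \<beta> > 0"
    using Im_cayley_pos assms(1,2) by (simp_all add: \<alpha>_def \<beta>_def)
  then have nz: "\<alpha> \<noteq> 0" "\<beta> \<noteq> 0" "\<alpha> + \<beta> \<noteq> 0"
    by (auto simp: complex_eq_iff)
  define n where "n = (\<alpha> + \<beta>) / 2"
  have "n \<noteq> 0" using nz by (simp add: n_def)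
  have n: "(cayley z + cayley w) / 2 - \<xi> = n" "((cayley z - cayley w) / 2)\<^sup>2 = n\<^sup>2 - \<alpha> * \<beta>"
    by (simp_all add: \<alpha>_def \<beta>_def n_def power2_eq_square field_simps)
  have u: "u = \<alpha> * \<beta> / n"
    unfolding u_def pole_coord_def n using \<open>n \<noteq> 0\<close> by (simp add: power2_eq_square field_simps)
  have inv: "- 1 / u = (- 1 / \<alpha> + - 1 / \<beta>) / 2"
    unfolding u using nz by (simp add: n_def field_simps)
  have Iminv: "Im (- 1 / x) = Im x / (cmod x)\<^sup>2" for x
    by (simp add: Im_divide cmod_power2)
  have "Im (- 1 / u) = (Im (- 1 / \<alpha>) + Im (- 1 / \<beta>)) / 2"
    unfolding inv by simp
  also have "\<dots> > 0"
    unfolding Iminv using pos nz by (simp add: add_pos_pos)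
  finally have "Im (- 1 / u) > 0" .
  then show "Im u > 0"
    unfolding Iminv by (simp add: zero_less_divide_iff)
  show "(cayley (\<omega> * z) + cayley (\<omega> * w)) / 2 = of_real (- \<xi>) + of_real (1 + \<xi>\<^sup>2) * (- 1 / u)"
    unfolding inv \<omega>_def cayley_rotation[OF assms(1)] cayley_rotation[OF assms(2)]
    unfolding \<alpha>_def[symmetric] \<beta>_def[symmetric] using nz by (simp add: field_simps)
qed

text \<open>
  Extremality of \<open>\<omega> = 1\<close> says that every pole coordinate contracts the distance of the midpoints,
  because the maps that take \<open>pole_coord \<xi>\<close> to the rotated midpoint are automorphisms of the
  half-plane. So the Pick conditions hold for all real \<open>\<xi>\<close> at once.
\<close>
lemma quadratic_disc_through_extremal_pair:
  assumes D: "cmod z1 < 1" "cmod w1 < 1" "cmod z2 < 1" "cmod w2 < 1"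
  defines "m1 \<equiv> (cayley z1 + cayley w1) / 2" and "m2 \<equiv> (cayley z2 + cayley w2) / 2"
  assumes ne: "m1 \<noteq> m2"
    and ext: "\<And>\<omega>. cmod \<omega> = 1 \<Longrightarrow>
      halfplane_dist ((cayley (\<omega> * z1) + cayley (\<omega> * w1)) / 2) ((cayley (\<omega> * z2) + cayley (\<omega> * w2)) / 2)
        \<le> halfplane_dist m1 m2"
  obtains A B C where "A \<le> 1" "\<And>\<xi>. A * \<xi>\<^sup>2 + B * \<xi> + C \<ge> 0"
    "((cayley z1 - cayley w1) / 2)\<^sup>2 = real_quadratic A B C m1"
    "((cayley z2 - cayley w2) / 2)\<^sup>2 = real_quadratic A B C m2"
proof -
  define D1 where "D1 = ((cayley z1 - cayley w1) / 2)\<^sup>2"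
  define D2 where "D2 = ((cayley z2 - cayley w2) / 2)\<^sup>2"
  have m: "Im m1 > 0" "Im m2 > 0"
    using Im_cayley_pos D by (simp_all add: m1_def m2_def add_pos_pos)
  have pos: "Im (pole_coord \<xi> m1 D1) > 0" "Im (pole_coord \<xi> m2 D2) > 0" for \<xi>
    unfolding D1_def D2_def m1_def m2_def using D by (auto intro!: midpoint_rotated(2))
  have le: "halfplane_dist (pole_coord \<xi> m1 D1) (pole_coord \<xi> m2 D2) \<le> halfplane_dist m1 m2" for \<xi>
  proof -
    define \<omega> where "\<omega> = (complex_of_real \<xi> + \<i>) / (complex_of_real \<xi> - \<i>)"
    have "complex_of_real \<xi> - \<i> \<noteq> 0" by (auto simp: complex_eq_iff)
    moreover have "cmod (complex_of_real \<xi> + \<i>) = cmod (complex_of_real \<xi> - \<i>)"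
      by (simp add: cmod_def)
    ultimately have "cmod \<omega> = 1" by (simp add: \<omega>_def norm_divide)
    have "0 < 1 + \<xi>\<^sup>2" by (simp add: add_pos_nonneg)
    have nz: "pole_coord \<xi> m1 D1 \<noteq> 0" "pole_coord \<xi> m2 D2 \<noteq> 0"
      using pos[of \<xi>] by auto
    have "halfplane_dist (pole_coord \<xi> m1 D1) (pole_coord \<xi> m2 D2) =
      halfplane_dist (of_real (- \<xi>) + of_real (1 + \<xi>\<^sup>2) * (- 1 / pole_coord \<xi> m1 D1))
                     (of_real (- \<xi>) + of_real (1 + \<xi>\<^sup>2) * (- 1 / pole_coord \<xi> m2 D2))"
      using \<open>0 < 1 + \<xi>\<^sup>2\<close> by (simp only: halfplane_dist_real_affine halfplane_dist_inversion[OF nz])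
    also have "\<dots> = halfplane_dist ((cayley (\<omega> * z1) + cayley (\<omega> * w1)) / 2)
                                   ((cayley (\<omega> * z2) + cayley (\<omega> * w2)) / 2)"
      unfolding \<omega>_def D1_def D2_def m1_def m2_def using D by (simp only: midpoint_rotated(1))
    also have "\<dots> \<le> halfplane_dist m1 m2" using \<open>cmod \<omega> = 1\<close> by (rule ext)
    finally show ?thesis .
  qed
  obtain A B C where q: "D1 = real_quadratic A B C m1" "D2 = real_quadratic A B C m2"
    using interpolate_real_quadratic[OF m ne pick_stationary[OF m pos le]] by metis
  note pick = pick_quadratic_nonneg[OF m ne q pos le]
  show thesis
    by (rule that[of A B C]) (use pick q in \<open>simp_all add: D1_def D2_def\<close>)
qed

section \<open>The Caratheodory distance\<close>

lemma norm_sum_less_2: "(s, p) \<in> sym_bidisc \<Longrightarrow> cmod s < 2"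
proof -
  assume "(s, p) \<in> sym_bidisc"
  then obtain z w where "s = z + w" "cmod z < 1" "cmod w < 1"
    by (auto simp: sym_bidisc_def)
  then show "cmod s < 2" using norm_triangle_ineq[of z w] by simp
qed

lemma Phi_denominator_nonzero:
  assumes "(s, p) \<in> sym_bidisc" "cmod \<omega> = 1"
  shows "2 - \<omega> * s \<noteq> 0"
proof
  assume "2 - \<omega> * s = 0"
  then have "cmod (\<omega> * s) = 2" by simp
  then show False using norm_sum_less_2[OF assms(1)] assms(2) by (simp add: norm_mult)
qed

lemma analytic2_on_Phi:
  assumes "cmod \<omega> = 1"
  shows "analytic2_on (Phi \<omega>) sym_bidisc"
  unfolding analytic2_on_def
proof (safe, goal_cases)
  case (1 s p)
  define d where "d = 2 - \<omega> * s"
  have d: "d \<noteq> 0" using Phi_denominator_nonzero[OF 1 assms] by (simp add: d_def)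
  have Phi: "Phi \<omega> = (\<lambda>x. (2 * \<omega> * snd x - fst x) / (2 - \<omega> * fst x))"
    by (auto simp: Phi_def)
  have "(Phi \<omega> has_derivative (\<lambda>x. ((2 * \<omega> * snd x - fst x) * d + (2 * \<omega> * p - s) * (\<omega> * fst x)) / (d * d)))
      (at (s, p) within sym_bidisc)"
    unfolding Phi using d
    by (auto intro!: derivative_eq_intros simp: d_def divide_simps)
  moreover have "(\<lambda>x. ((2 * \<omega> * snd x - fst x) * d + (2 * \<omega> * p - s) * (\<omega> * fst x)) / (d * d)) =
     (\<lambda>(h, k). ((2 * \<omega> * p - s) * \<omega> - d) / (d * d) * h + 2 * \<omega> / d * k)"
    using d by (auto simp: fun_eq_iff field_simps)
  ultimately show ?case by metis
qed

lemma pseudohyp_dist_Phi_formula: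
  assumes x: "(s1, p1) \<in> sym_bidisc" and y: "(s2, p2) \<in> sym_bidisc" and \<omega>: "cmod \<omega> = 1"
  shows "pseudohyp_dist (Phi \<omega> (s1, p1)) (Phi \<omega> (s2, p2)) =
    cmod (((s2 * p1 - s1 * p2) * \<omega>\<^sup>2 + 2 * (p2 - p1) * \<omega> + s1 - s2)
        / ((s1 - cnj s2 * p1) * \<omega>\<^sup>2 - 2 * (1 - p1 * cnj p2) * \<omega> + cnj s2 - s1 * cnj p2))"
    (is "_ = cmod (?N / ?D)")
proof -
  define a b where "a = 2 - \<omega> * s1" and "b = 2 - \<omega> * s2"
  have "a \<noteq> 0" "b \<noteq> 0"
    using Phi_denominator_nonzero[OF x \<omega>] Phi_denominator_nonzero[OF y \<omega>] by (simp_all add: a_def b_def)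
  then have ab: "a \<noteq> 0" "b \<noteq> 0" "cnj b \<noteq> 0" by auto
  have w: "\<omega> * cnj \<omega> = 1" using \<omega> by (simp flip: complex_norm_square)
  have w0: "\<omega> \<noteq> 0" using \<omega> by auto
  have "Phi \<omega> (s1, p1) - Phi \<omega> (s2, p2) =
      ((2 * \<omega> * p1 - s1) * b - (2 * \<omega> * p2 - s2) * a) / (a * b)"
    using ab by (simp add: Phi_def field_simps flip: a_def b_def)
  also have "(2 * \<omega> * p1 - s1) * b - (2 * \<omega> * p2 - s2) * a = - 2 * ?N"
    by (simp add: a_def b_def power2_eq_square algebra_simps)
  finally have num: "Phi \<omega> (s1, p1) - Phi \<omega> (s2, p2) = - 2 * ?N / (a * b)" .
  have "1 - cnj (Phi \<omega> (s2, p2)) * Phi \<omega> (s1, p1) =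
      (cnj b * a - cnj (2 * \<omega> * p2 - s2) * (2 * \<omega> * p1 - s1)) / (a * cnj b)"
    using ab by (simp add: Phi_def divide_simps flip: a_def b_def)
  moreover have "\<omega> * (cnj b * a - cnj (2 * \<omega> * p2 - s2) * (2 * \<omega> * p1 - s1)) = - 2 * ?D"
    using w unfolding a_def b_def complex_cnj_diff complex_cnj_mult complex_cnj_numeral by algebra
  ultimately have den: "1 - cnj (Phi \<omega> (s2, p2)) * Phi \<omega> (s1, p1) = - 2 * ?D / (\<omega> * (a * cnj b))"
    using w0 by (metis mult_divide_mult_cancel_left)
  show ?thesis
    unfolding pseudohyp_dist_def num den using ab \<omega> by (simp only: norm_divide norm_mult) simp
qed

text \<open>
  The equality \<open>\<Phi>\<^sub>\<omega>(x) = \<Phi>\<^sub>\<omega>(y)\<close> is a polynomial equation of degree at most 2 in \<open>\<omega>\<close>; the three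
  roots \<open>1\<close>, \<open>-1\<close>, \<open>\<i>\<close> make all its coefficients vanish.
\<close>
lemma sym_bidisc_eqI_Phi:
  assumes x: "(s1, p1) \<in> sym_bidisc" and y: "(s2, p2) \<in> sym_bidisc"
    and eq: "\<And>\<omega>. cmod \<omega> = 1 \<Longrightarrow> Phi \<omega> (s1, p1) = Phi \<omega> (s2, p2)"
  shows "(s1, p1) = (s2, p2)"
proof -
  have N: "(s2 * p1 - s1 * p2) * \<omega>\<^sup>2 + 2 * (p2 - p1) * \<omega> + s1 - s2 = 0" if "cmod \<omega> = 1" for \<omega>
  proof -
    have "(2 * \<omega> * p1 - s1) * (2 - \<omega> * s2) = (2 * \<omega> * p2 - s2) * (2 - \<omega> * s1)"
      using eq[OF that] Phi_denominator_nonzero[OF x that] Phi_denominator_nonzero[OF y that]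
      by (simp add: Phi_def frac_eq_eq)
    then show ?thesis by algebra
  qed
  define c where "c = s2 * p1 - s1 * p2"
  have "c + 2 * (p2 - p1) + s1 - s2 = 0" "c - 2 * (p2 - p1) + s1 - s2 = 0" "- c + 2 * (p2 - p1) * \<i> + s1 - s2 = 0"
    using N[of 1] N[of "- 1"] N[of \<i>] by (simp_all add: c_def algebra_simps)
  then have "p1 = p2" "s1 = s2" by algebra+
  then show ?thesis by simp
qed

text \<open>
  Rotating both points by \<open>\<omega>\<close> makes 1 the extremal parameter, so the rotated points lie on a
  quadratic disc; the disc is rotated back by \<open>cnj \<omega>\<close>. If the two midpoints coincide there is no such
  disc to construct: the maximum is 0 and the points are equal.
\<close>
lemma pseudohyp_dist_le_extremal_Phi:
  assumes F: "analytic2_on F sym_bidisc" "F ` sym_bidisc \<subseteq> ball 0 1"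
    and x: "x \<in> sym_bidisc" and y: "y \<in> sym_bidisc" and \<omega>: "cmod \<omega> = 1"
    and max: "\<And>\<zeta>. cmod \<zeta> = 1 \<Longrightarrow>
      pseudohyp_dist (Phi \<zeta> x) (Phi \<zeta> y) \<le> pseudohyp_dist (Phi \<omega> x) (Phi \<omega> y)"
  shows "pseudohyp_dist (F x) (F y) \<le> pseudohyp_dist (Phi \<omega> x) (Phi \<omega> y)"
proof -
  obtain z1 w1 where x': "x = (z1 + w1, z1 * w1)" and D1: "cmod z1 < 1" "cmod w1 < 1"
    using x by (auto simp: sym_bidisc_def)
  obtain z2 w2 where y': "y = (z2 + w2, z2 * w2)" and D2: "cmod z2 < 1" "cmod w2 < 1"
    using y by (auto simp: sym_bidisc_def)
  have rot: "cmod (\<omega> * z1) < 1" "cmod (\<omega> * w1) < 1" "cmod (\<omega> * z2) < 1" "cmod (\<omega> * w2) < 1"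
    using D1 D2 \<omega> by (simp_all add: norm_mult)
  define m1 where "m1 = (cayley (\<omega> * z1) + cayley (\<omega> * w1)) / 2"
  define m2 where "m2 = (cayley (\<omega> * z2) + cayley (\<omega> * w2)) / 2"
  define v1 where "v1 = (cayley (\<omega> * z1) - cayley (\<omega> * w1)) / 2"
  define v2 where "v2 = (cayley (\<omega> * z2) - cayley (\<omega> * w2)) / 2"
  have dist: "pseudohyp_dist (Phi \<omega> x) (Phi \<omega> y) = halfplane_dist m1 m2"
    unfolding x' y' m1_def m2_def by (rule pseudohyp_dist_Phi[OF D1 D2 \<omega>])
  show ?thesis
  proof (cases "m1 = m2")
    case True
    have "Phi \<zeta> x = Phi \<zeta> y" if "cmod \<zeta> = 1" for \<zeta>
    proof -
      have "pseudohyp_dist (Phi \<zeta> x) (Phi \<zeta> y) \<le> 0"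
        using max[OF that] unfolding dist True by (simp add: halfplane_dist_def)
      moreover have "1 - cnj (Phi \<zeta> y) * Phi \<zeta> x \<noteq> 0"
        using norm_Phi_less_1[OF x that] norm_Phi_less_1[OF y that]
        by (rule pseudohyp_denominator_nonzero)
      ultimately show ?thesis by (simp add: pseudohyp_dist_def)
    qed
    then have "x = y" using sym_bidisc_eqI_Phi x y unfolding x' y' by blast
    then show ?thesis by (simp add: pseudohyp_dist_def)
  next
    case False
    have ext: "halfplane_dist ((cayley (\<zeta> * (\<omega> * z1)) + cayley (\<zeta> * (\<omega> * w1))) / 2)
                    ((cayley (\<zeta> * (\<omega> * z2)) + cayley (\<zeta> * (\<omega> * w2))) / 2)
        \<le> halfplane_dist m1 m2" if "cmod \<zeta> = 1" for \<zeta>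
    proof -
      have u: "cmod (\<zeta> * \<omega>) = 1" using that \<omega> by (simp add: norm_mult)
      show ?thesis
        using max[OF u] pseudohyp_dist_Phi[OF D1 D2 u] dist by (simp add: x' y' mult.assoc)
    qed
    obtain A B C where A: "A \<le> 1" "\<And>\<xi>. A * \<xi>\<^sup>2 + B * \<xi> + C \<ge> 0"
      and v: "v1\<^sup>2 = real_quadratic A B C m1" "v2\<^sup>2 = real_quadratic A B C m2"
      by (rule quadratic_disc_through_extremal_pair[OF rot,
            folded m1_def m2_def v1_def v2_def, OF False ext], assumption, rule that)
    have pm: "m1 + v1 = cayley (\<omega> * z1)" "m1 - v1 = cayley (\<omega> * w1)"
             "m2 + v2 = cayley (\<omega> * z2)" "m2 - v2 = cayley (\<omega> * w2)"
      by (simp_all add: m1_def v1_def m2_def v2_def field_simps)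
    have pos: "Im (m1 + v1) > 0" "Im (m1 - v1) > 0" "Im (m2 + v2) > 0" "Im (m2 - v2) > 0"
      unfolding pm using rot by (auto intro!: Im_cayley_pos)
    then have Im: "\<bar>Im v1\<bar> < Im m1" "\<bar>Im v2\<bar> < Im m2" by auto
    have ne1: "\<omega> * z1 \<noteq> 1" "\<omega> * w1 \<noteq> 1" "\<omega> * z2 \<noteq> 1" "\<omega> * w2 \<noteq> 1" using rot by auto
    have coords: "sym_cayley_inv m1 (v1\<^sup>2) = (\<omega> * z1 + \<omega> * w1, \<omega> * z1 * (\<omega> * w1))"
               "sym_cayley_inv m2 (v2\<^sup>2) = (\<omega> * z2 + \<omega> * w2, \<omega> * z2 * (\<omega> * w2))"
      using pos ne1 by (simp_all only: sym_cayley_inv_square pm ne1[THEN cayley_inv_cayley])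
    have "cnj \<omega> * \<omega> = 1" using \<omega> by (simp add: mult.commute flip: complex_norm_square)
    then have unrot: "cnj \<omega> * (\<omega> * z + \<omega> * w) = z + w" "(cnj \<omega>)\<^sup>2 * (\<omega> * z * (\<omega> * w)) = z * w" for z w
      by algebra+
    have "cmod (cnj \<omega>) = 1" using \<omega> by simp
    from pseudohyp_dist_le_on_quadratic_disc[OF F this A Im v]
    show ?thesis
      unfolding dist by (simp only: coords fst_conv snd_conv unrot x' y')
  qed
qed

theorem corollary5p2:
  fixes s1 p1 s2 p2 :: complex
  assumes "(s1, p1) \<in> sym_bidisc" and "(s2, p2) \<in> sym_bidisc"
  shows "caratheodory_dist sym_bidisc (s1, p1) (s2, p2)
           = (SUP \<omega>\<in>sphere 0 1. pseudohyp_dist (Phi \<omega> (s1, p1)) (Phi \<omega> (s2, p2)))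
       \<and> (SUP \<omega>\<in>sphere 0 1. pseudohyp_dist (Phi \<omega> (s1, p1)) (Phi \<omega> (s2, p2)))
           = (SUP \<omega>\<in>sphere (0::complex) 1.
               cmod (((s2 * p1 - s1 * p2) * \<omega>\<^sup>2 + 2 * (p2 - p1) * \<omega> + s1 - s2)
                   / ((s1 - cnj s2 * p1) * \<omega>\<^sup>2 - 2 * (1 - p1 * cnj p2) * \<omega> + cnj s2 - s1 * cnj p2)))"
proof
  let ?x = "(s1, p1)" and ?y = "(s2, p2)"
  define R where "R = (\<lambda>\<omega>. pseudohyp_dist (Phi \<omega> ?x) (Phi \<omega> ?y))"
  have nz: "1 - cnj (Phi \<omega> ?y) * Phi \<omega> ?x \<noteq> 0" if "cmod \<omega> = 1" for \<omega>
    using norm_Phi_less_1[OF assms(1) that] norm_Phi_less_1[OF assms(2) that]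
    by (rule pseudohyp_denominator_nonzero)
  have Phi_cont: "continuous_on (sphere 0 1) (\<lambda>\<omega>. Phi \<omega> v)" if "v \<in> sym_bidisc" for v
    using that Phi_denominator_nonzero unfolding Phi_def
    by (cases v) (auto intro!: continuous_intros)
  have "continuous_on (sphere 0 1) R"
    unfolding R_def pseudohyp_dist_def using nz assms
    by (intro continuous_intros Phi_cont) auto
  then obtain \<omega> where \<omega>: "cmod \<omega> = 1" and max: "\<And>\<zeta>. cmod \<zeta> = 1 \<Longrightarrow> R \<zeta> \<le> R \<omega>"
    using continuous_attains_sup[of "sphere 0 1" R] by auto
  have sup: "(SUP \<omega>\<in>sphere 0 1. R \<omega>) = R \<omega>"
    by (rule cSup_eq_maximum) (use \<omega> max in auto)
  let ?A = "{F. analytic2_on F sym_bidisc \<and> F ` sym_bidisc \<subseteq> ball 0 1}"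
  have mem: "Phi \<omega> \<in> ?A"
    using analytic2_on_Phi[OF \<omega>] norm_Phi_less_1[OF _ \<omega>] by auto
  have "(SUP F\<in>?A. pseudohyp_dist (F ?x) (F ?y)) = R \<omega>"
  proof (rule cSup_eq_maximum)
    show "R \<omega> \<in> (\<lambda>F. pseudohyp_dist (F ?x) (F ?y)) ` ?A"
      using mem unfolding R_def by blast
  next
    fix r assume "r \<in> (\<lambda>F. pseudohyp_dist (F ?x) (F ?y)) ` ?A"
    then obtain F where F: "analytic2_on F sym_bidisc" "F ` sym_bidisc \<subseteq> ball 0 1"
      and r: "r = pseudohyp_dist (F ?x) (F ?y)" by auto
    show "r \<le> R \<omega>"
      unfolding r R_def
      using pseudohyp_dist_le_extremal_Phi[OF F assms \<omega> max[unfolded R_def]] .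
  qed
  then show "caratheodory_dist sym_bidisc ?x ?y = (SUP \<omega>\<in>sphere 0 1. pseudohyp_dist (Phi \<omega> ?x) (Phi \<omega> ?y))"
    unfolding caratheodory_dist_def using sup by (simp add: R_def)
next
  show "(SUP \<omega>\<in>sphere 0 1. pseudohyp_dist (Phi \<omega> (s1, p1)) (Phi \<omega> (s2, p2)))
           = (SUP \<omega>\<in>sphere (0::complex) 1.
               cmod (((s2 * p1 - s1 * p2) * \<omega>\<^sup>2 + 2 * (p2 - p1) * \<omega> + s1 - s2)
                   / ((s1 - cnj s2 * p1) * \<omega>\<^sup>2 - 2 * (1 - p1 * cnj p2) * \<omega> + cnj s2 - s1 * cnj p2)))"
    using pseudohyp_dist_Phi_formula[OF assms] by (intro SUP_cong) auto
qed

end
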